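(* Let $m\ge 1$ and $0\le i\le m$ be integers. Then $D_i(m)$ equals the weight of $\mathcal{D}_i(m)$, that is, $$D_i(m)=\sum_{(\pi|\sigma)\in\mathcal{D}_i(m)} w(\pi|\sigma),$$ where $D_i(m)=\binom{2m}{m-i}\,m!\,i!\,(m-i)!\,2^i\,d_i(m)$, $d_i(m)$ is the coefficient of $a^i$ in the Boros-Moll polynomial $P_m(a)$, $\mathcal{D}_i(m)$ is the set of partially $2$-colored permutations $(\pi|\sigma)$ on $\{1,\dots,2m\}$ with exactly $m+i$ black elements, and $w(\pi|\sigma)=(1/2)^{(\text{number of white elements})+(\text{number of cycles of }\sigma)}$.
   Context: The Boros-Moll polynomials are $P_m(a)=2^{-2m}\sum_{k=0}^{m}2^k\binom{2m-2k}{m-k}\binom{m+k}{k}(a+1)^k$ for integers $m\ge 0$ (equivalently, $P_m(a)=\sum_{j,k}\binom{2m+1}{2j}\binom{m-j}{k}\binom{2k+2j}{k+j}\frac{(a+1)^j(a-1)^k}{2^{3(k+j)}}$). The coefficient of $a^i$ in $P_m(a)$ is $$d_i(m)=2^{-2m}\sum_{k=i}^{m}2^k\binom{2m-2k}{m-k}\binom{m+k}{k}\binom{k}{i}.$$ A composition of $[2m]=\{1,\dots,2m\}$ is an ordered triple $(A,B,C)$ of pairwise disjoint (possibly empty) sets with $A\cup B\cup C=[2m]$. A partially $2$-colored permutation on $[2m]$ associated with the composition $(A,B,C)$ is a pair $(\pi|\sigma)$, where $\pi$ is a permutation on $A\cup B$ (written in one-line notation, i.e. as a linear arrangement of the elements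 of $A\cup B$) and $\sigma$ is a permutation on $C$ (written as a product of disjoint cycles, fixed points counting as cycles). The elements of $A$ are colored white, the elements of $B$ are colored black, and the elements of $C$ are uncolored; the coloring (i.e. the composition) is part of the data. $\mathcal{D}_i(m)$ is the set of all partially $2$-colored permutations on $[2m]$, over all compositions $(A,B,C)$ with $|B|=m+i$ (so $|A\cup C|=m-i$). The weight $w(\pi|\sigma)$ is the product of the weights of the white elements and of the cycles of $\sigma$, where each element of $A$ has weight $\frac12$ and each cycle of $\sigma$ has weight $\frac12$ (an empty product is $1$). The weight of a set of such objects is the sum of the weights of its elements. *)

theory Defs
  imports
    "HOL-Computational_Algebra.Polynomial"
    "HOL-Combinatorics.Combinatorics"
begin

definition boros_moll_poly :: "nat \<Rightarrow> real poly" where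
  "boros_moll_poly m =
     smult (1 / 2 ^ (2 * m))
       (\<Sum>k=0..m. smult (2 ^ k * real ((2 * m - 2 * k) choose (m - k)) * real ((m + k) choose k))
                    ([:1, 1:] ^ k))"

definition boros_moll_coeff :: "nat \<Rightarrow> nat \<Rightarrow> real" where
  "boros_moll_coeff i m = coeff (boros_moll_poly m) i"

definition normalized_coeff :: "nat \<Rightarrow> nat \<Rightarrow> real" where
  "normalized_coeff i m =
     real ((2 * m) choose (m - i)) * fact m * fact i * fact (m - i) * 2 ^ i * boros_moll_coeff i m"

definition compositions :: "nat \<Rightarrow> (nat set \<times> nat set \<times> nat set) set" where
  "compositions m =
     {(A, B, C). A \<union> B \<union> C = {1..2 * m} \<and> A \<inter> B = {} \<and> A \<inter> C = {} \<and> B \<inter> C = {}}"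

text \<open>
  The linear arrangement is a duplicate-free list. The permutation of \<open>C\<close> is a function that
  fixes everything outside \<open>C\<close>, so each permutation of \<open>C\<close> is represented exactly once.
\<close>

type_synonym colored_perm = "(nat set \<times> nat set \<times> nat set) \<times> nat list \<times> (nat \<Rightarrow> nat)"

definition colored_perms :: "nat \<Rightarrow> colored_perm set" where
  "colored_perms m =
     {((A, B, C), \<pi>, \<sigma>).
        (A, B, C) \<in> compositions m \<and> \<pi> \<in> permutations_of_set (A \<union> B) \<and> \<sigma> permutes C}"

definition colored_perms_black :: "nat \<Rightarrow> nat \<Rightarrow> colored_perm set" where
  "colored_perms_black i m = {((A, B, C), \<pi>, \<sigma>) \<in> colored_perms m. card B = m + i}"

text \<open>
  The cycles of a permutation of \<open>C\<close> are its orbits on \<open>C\<close>; fixed points in \<open>C\<close> give singleton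
  cycles, while the points outside \<open>C\<close> do not contribute.
\<close>

definition perm_cycles :: "(nat \<Rightarrow> nat) \<Rightarrow> nat set \<Rightarrow> nat set set" where
  "perm_cycles \<sigma> C = orbit \<sigma> ` C"

fun weight :: "colored_perm \<Rightarrow> real" where
  "weight ((A, B, C), \<pi>, \<sigma>) = (1 / 2) ^ (card A + card (perm_cycles \<sigma> C))"

text \<open>A sum over an infinite set would be 0 by convention; the index set here is finite.\<close>

lemma finite_colored_perms: "finite (colored_perms m)"
proof -
  let ?S = "Pow {1..2 * m} \<times> Pow {1..2 * m} \<times> Pow {1..2 * m}"
  have "finite (Sigma ?S
          (\<lambda>(A, B, C). permutations_of_set (A \<union> B) \<times> {\<sigma>. \<sigma> permutes C}))"
    by (intro finite_SigmaI)
       (auto intro!: finite_cartesian_product finite_permutations intro: finite_subset)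
  moreover have "colored_perms m \<subseteq> Sigma ?S
          (\<lambda>(A, B, C). permutations_of_set (A \<union> B) \<times> {\<sigma>. \<sigma> permutes C})"
    unfolding colored_perms_def compositions_def by auto
  ultimately show ?thesis by (rule finite_subset[rotated])
qed

lemma finite_colored_perms_black: "finite (colored_perms_black i m)"
  by (rule finite_subset[OF _ finite_colored_perms[of m]]) (auto simp: colored_perms_black_def)

end

theory Submission
  imports Defs
begin

text \<open>
  Both sides are finite sums over one index \<open>j\<close>, and the two sums agree term by term.

  On the combinatorial side, choose the black set \<open>B\<close> in \<open>(2 * m) choose (m - i)\<close> ways, then a
  white set \<open>A\<close> of size \<open>j\<close> inside the remaining \<open>m - i\<close> elements; what is left is \<open>C\<close>. The
  arrangement \<open>\<pi>\<close> does not influence the weight and gives the factor \<open>fact (m + i + j)\<close>. The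
  permutation \<open>\<sigma>\<close> of the \<open>n = m - i - j\<close> elements of \<open>C\<close> contributes the cycle generating
  function of the symmetric group at \<open>1 / 2\<close>, which is the rising factorial
  \<open>pochhammer (1 / 2) n\<close> (lemma \<open>sum_power_card_cycles\<close>).

  On the analytic side, the expansion of \<open>(a + 1) ^ k\<close> gives the coefficient as a sum over
  \<open>k = i + j\<close>, in which the central binomial coefficient \<open>2 * n choose n\<close> occurs with the same
  \<open>n = m - k\<close>. The link is the identity \<open>(2 * n choose n) / 4 ^ n = pochhammer (1 / 2) n / fact n\<close>:
  up to the factor \<open>fact n / 4 ^ n\<close>, a central binomial coefficient counts permutations in which
  each cycle weighs \<open>1 / 2\<close>.
\<close>

section \<open>Cycles of a permutation weighted individually\<close>

lemma orbit_eq_iff: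
  assumes "permutation f"
  shows "orbit f x = orbit f y \<longleftrightarrow> x \<in> orbit f y"
proof
  assume "orbit f x = orbit f y"
  then show "x \<in> orbit f y"
    using permutation_self_in_orbit[OF assms, of x] by simp
next
  assume x: "x \<in> orbit f y"
  then have "y \<in> orbit f x"
    using orbit_swap permutation_self_in_orbit[OF assms] by metis
  with x show "orbit f x = orbit f y"
    by (auto intro: orbit_trans)
qed

text \<open>
  Composing \<open>p\<close> with \<open>transpose a b\<close> inserts the new point \<open>a\<close> immediately before \<open>b\<close> in the cycle
  of \<open>b\<close>. A walk along the cycles therefore meets the same old points, apart from a possible
  detour through \<open>a\<close>.
\<close>

lemma orbit_transpose_comp_iff:
  assumes p: "p permutes S" and a: "a \<notin> S" and b: "b \<in> S" and x: "x \<in> S" and y: "y \<in> S"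
  shows "y \<in> orbit (transpose a b \<circ> p) x \<longleftrightarrow> y \<in> orbit p x"
proof
  let ?q = "transpose a b \<circ> p"
  have pS: "p z \<in> S" if "z \<in> S" for z
    using p that by (simp add: permutes_in_image)
  have sub: "orbit p x \<subseteq> S"
    using p x by (rule permutes_orbit_subset)
  have pa: "p a = a" using p a by (rule permutes_not_in)
  have q: "?q z = (if p z = b then a else p z)" if "z \<in> S" for z
    using pS[OF that] a by (auto simp: transpose_def)
  have qa: "?q a = b" using pa by simp
  show "y \<in> orbit p x" if "y \<in> orbit ?q x"
  proof -
    \<comment> \<open>The walk may currently stand at \<open>a\<close>, in which case its next step goes to \<open>b\<close>.\<close>
    from that have "y \<in> orbit p x \<or> y = a \<and> b \<in> orbit p x"
    proof induction
      case base
      show ?case using q[OF x] orbit.base[of p x] by (auto split: if_splits)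
    next
      case (step z)
      show ?case
      proof (cases "z = a")
        case True
        with step.IH sub a qa show ?thesis by auto
      next
        case False
        with step.IH have z: "z \<in> orbit p x" by simp
        then have "p z \<in> orbit p x" by (rule orbit.step)
        with q[of z] z sub show ?thesis by (auto split: if_splits)
      qed
    qed
    with y a show ?thesis by auto
  qed
  show "y \<in> orbit ?q x" if "y \<in> orbit p x"
    using that
  proof induction
    case base
    show ?case
    proof (cases "p x = b")
      case True
      then have "a \<in> orbit ?q x" using q[OF x] orbit.base[of ?q x] by simp
      then have "?q a \<in> orbit ?q x" by (rule orbit.step)
      then show ?thesis by (simp only: qa True)
    next
      case False
      then have "?q x = p x" using q[OF x] by simp
      then show ?thesis using orbit.base[of ?q x] by (simp only:)
    qed
  next
    case (step z)
    have zS: "z \<in> S" using step.hyps sub by auto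
    have qz: "?q z \<in> orbit ?q x" using step.IH by (rule orbit.step)
    show ?case
    proof (cases "p z = b")
      case True
      then have "a \<in> orbit ?q x" using q[OF zS] qz by simp
      then have "?q a \<in> orbit ?q x" by (rule orbit.step)
      then show ?thesis by (simp only: qa True)
    next
      case False
      then have "?q z = p z" using q[OF zS] by simp
      with qz show ?thesis by (simp only:)
    qed
  qed
qed

lemma card_image_eq_if_same_kernel:
  assumes "\<And>x y. x \<in> S \<Longrightarrow> y \<in> S \<Longrightarrow> f x = f y \<longleftrightarrow> g x = g y"
  shows "card (f ` S) = card (g ` S)"
proof (rule bij_betw_same_card)
  show "bij_betw (\<lambda>u. g (inv_into S f u)) (f ` S) (g ` S)"
    unfolding bij_betw_def
  proof
    show "inj_on (\<lambda>u. g (inv_into S f u)) (f ` S)"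
      by (rule inj_onI) (metis assms f_inv_into_f inv_into_into)
    show "(\<lambda>u. g (inv_into S f u)) ` f ` S = g ` S"
      unfolding image_image
      by (rule image_cong) (auto simp: assms[symmetric] f_inv_into_f inv_into_into)
  qed
qed

lemma card_perm_cycles_insert_fixed:
  assumes p: "p permutes S" and "finite S" and a: "a \<notin> S"
  shows "card (perm_cycles p (insert a S)) = Suc (card (perm_cycles p S))"
proof -
  have "orbit p a = {a}"
    using permutes_not_in[OF p a] by (simp add: orbit_eq_singleton_iff)
  moreover have "{a} \<notin> orbit p ` S"
    using permutes_orbit_subset[OF p] a by fastforce
  ultimately show ?thesis
    using \<open>finite S\<close> by (simp add: perm_cycles_def)
qed

lemma card_perm_cycles_transpose_comp:
  assumes p: "p permutes S" and fin: "finite S" and a: "a \<notin> S" and b: "b \<in> S"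
  shows "card (perm_cycles (transpose a b \<circ> p) (insert a S)) = card (perm_cycles p S)"
proof -
  let ?q = "transpose a b \<circ> p"
  have perm_p: "permutation p"
    using p fin by (auto simp: permutation_permutes)
  then have perm_q: "permutation ?q"
    by (intro permutation_compose permutation_swap_id)
  have "?q a = b" using permutes_not_in[OF p a] by simp
  then have "orbit ?q a = orbit ?q b"
    using permutation_orbit_step[OF perm_q, of a] by simp
  then have "orbit ?q ` insert a S = orbit ?q ` S" using b by auto
  moreover have "card (orbit ?q ` S) = card (orbit p ` S)"
    by (rule card_image_eq_if_same_kernel)
      (simp only: orbit_eq_iff[OF perm_p] orbit_eq_iff[OF perm_q]
        orbit_transpose_comp_iff[OF p a b])
  ultimately show ?thesis by (simp only: perm_cycles_def)
qed

text \<open>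
  A new point is either a cycle of its own, which contributes a factor \<open>x\<close>, or is inserted before
  one of the \<open>n\<close> old points without changing the number of cycles; so each new point multiplies
  the sum by \<open>x + n\<close>.
\<close>

lemma sum_power_card_cycles:
  fixes x :: "'a :: comm_semiring_1"
  assumes "finite S"
  shows "(\<Sum>p | p permutes S. x ^ card (perm_cycles p S)) = pochhammer x (card S)"
  using assms
proof induction
  case empty
  then show ?case by (simp add: perm_cycles_def)
next
  case (insert a S)
  let ?P = "\<lambda>S. {p. p permutes S}"
  have new: "(\<Sum>p\<in>?P S. x ^ card (perm_cycles (transpose a a \<circ> p) (insert a S)))
      = x * pochhammer x (card S)"
    using insert by (simp add: card_perm_cycles_insert_fixed sum_distrib_left flip: insert.IH)
  have old: "(\<Sum>p\<in>?P S. x ^ card (perm_cycles (transpose a b \<circ> p) (insert a S)))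
      = pochhammer x (card S)" if "b \<in> S" for b
    using insert that by (simp add: card_perm_cycles_transpose_comp flip: insert.IH)
  show ?case
    unfolding sum_over_permutations_insert[OF insert.hyps]
    using insert.hyps by (simp add: new old pochhammer_Suc algebra_simps del: transpose_same)
qed

section \<open>The weight of the colored permutations\<close>

lemma sum_Pow_by_card:
  fixes g :: "nat \<Rightarrow> 'a :: comm_semiring_1"
  assumes "finite T"
  shows "(\<Sum>A\<in>Pow T. g (card A)) = (\<Sum>j\<le>card T. of_nat (card T choose j) * g j)"
proof -
  have "(\<Sum>A\<in>Pow T. g (card A)) = (\<Sum>j\<le>card T. \<Sum>A | A \<in> Pow T \<and> card A = j. g (card A))"
    using assms by (intro sum.group[symmetric]) (auto intro: card_mono)
  also have "\<dots> = (\<Sum>j\<le>card T. of_nat (card T choose j) * g j)"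
    using assms by (intro sum.cong) (auto simp: n_subsets)
  finally show ?thesis .
qed

lemma sum_weight_colored_perms_black:
  assumes "i \<le> m"
  shows "(\<Sum>x\<in>colored_perms_black i m. weight x) =
    real ((2 * m) choose (m - i)) *
      (\<Sum>j\<le>m - i. real ((m - i) choose j) *
        ((1 / 2) ^ j * fact (m + i + j) * pochhammer (1 / 2) (m - i - j)))"
proof -
  let ?U = "{1..2 * m}"
  let ?Bs = "{B. B \<subseteq> ?U \<and> card B = m + i}"
  let ?Ps = "\<lambda>B A. permutations_of_set (A \<union> B) \<times> {\<sigma>. \<sigma> permutes ?U - B - A}"
  let ?X = "SIGMA B : ?Bs. SIGMA A : Pow (?U - B). ?Ps B A"
  let ?h = "\<lambda>j. (1 / 2) ^ j * fact (m + i + j) * pochhammer (1 / 2 :: real) (m - i - j)"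
  have finU: "finite B" if "B \<subseteq> ?U" for B
    using that by (rule finite_subset) simp
  have comp: "(A, B, C) \<in> compositions m \<longleftrightarrow> B \<subseteq> ?U \<and> A \<subseteq> ?U - B \<and> C = ?U - B - A"
    for A B C
    unfolding compositions_def by auto
  have fin: "finite (?Ps B A)" "finite (Sigma (Pow (?U - B)) (?Ps B))" for B A
    by (auto intro!: finite_SigmaI finite_permutations finite_cartesian_product)
  have "(\<Sum>x\<in>colored_perms_black i m. weight x)
      = (\<Sum>(B, A, \<pi>, \<sigma>)\<in>?X. weight ((A, B, ?U - B - A), \<pi>, \<sigma>))"
    \<comment> \<open>The uncolored set is determined by the other two, so it is dropped from the index.\<close>
    by (rule sum.reindex_bij_witness[of _ "\<lambda>(B, A, \<pi>, \<sigma>). ((A, B, ?U - B - A), \<pi>, \<sigma>)"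
          "\<lambda>((A, B, C), \<pi>, \<sigma>). (B, A, \<pi>, \<sigma>)"])
      (auto simp: colored_perms_black_def colored_perms_def comp)
  also have "\<dots> = (\<Sum>B\<in>?Bs. \<Sum>A\<in>Pow (?U - B). \<Sum>(\<pi>, \<sigma>)\<in>?Ps B A.
      weight ((A, B, ?U - B - A), \<pi>, \<sigma>))"
    using fin by (simp add: sum.Sigma split_def)
  also have "\<dots> = (\<Sum>B\<in>?Bs. \<Sum>A\<in>Pow (?U - B). ?h (card A))"
  proof (intro sum.cong refl)
    fix B A assume B: "B \<in> ?Bs" and A: "A \<in> Pow (?U - B)"
    have finB: "finite B" using B finU by auto
    have finA: "finite A" using A by (auto intro: finite_subset)
    have cAB: "card (A \<union> B) = m + i + card A"
      using A B finA finB by (subst card_Un_disjoint) auto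
    have finC: "finite (?U - B - A)" by simp
    have cC: "card (?U - B - A) = m - i - card A"
      using A B finA finB by (simp add: card_Diff_subset)
    have "(\<Sum>(\<pi>, \<sigma>)\<in>?Ps B A. weight ((A, B, ?U - B - A), \<pi>, \<sigma>))
        = (\<Sum>\<pi>\<in>permutations_of_set (A \<union> B). (1 / 2) ^ card A *
            (\<Sum>\<sigma> | \<sigma> permutes ?U - B - A. (1 / 2) ^ card (perm_cycles \<sigma> (?U - B - A))))"
      by (simp add: sum.cartesian_product[symmetric] power_add sum_distrib_left)
    also have "\<dots> = ?h (card A)"
      using finA finB by (simp only: sum_power_card_cycles[OF finC] cC) (simp add: cAB)
    finally show "(\<Sum>(\<pi>, \<sigma>)\<in>?Ps B A. weight ((A, B, ?U - B - A), \<pi>, \<sigma>)) = ?h (card A)" .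
  qed
  also have "\<dots> = (\<Sum>B\<in>?Bs. \<Sum>j\<le>m - i. real ((m - i) choose j) * ?h j)"
  proof (intro sum.cong refl)
    fix B assume B: "B \<in> ?Bs"
    then have "card (?U - B) = m - i"
      using finU by (simp add: card_Diff_subset)
    then show "(\<Sum>A\<in>Pow (?U - B). ?h (card A)) = (\<Sum>j\<le>m - i. real ((m - i) choose j) * ?h j)"
      using sum_Pow_by_card[of "?U - B" ?h] by simp
  qed
  also have "card ?Bs = (2 * m) choose (m - i)"
    using n_subsets[of ?U "m + i"] binomial_symmetric[of "m + i" "2 * m"] assms
    by simp
  then have "(\<Sum>B\<in>?Bs. \<Sum>j\<le>m - i. real ((m - i) choose j) * ?h j)
      = real ((2 * m) choose (m - i)) * (\<Sum>j\<le>m - i. real ((m - i) choose j) * ?h j)"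
    by simp
  finally show ?thesis .
qed

section \<open>The coefficients of the polynomials\<close>

lemma boros_moll_coeff_eq_sum:
  assumes "i \<le> m"
  shows "boros_moll_coeff i m = 1 / 2 ^ (2 * m) *
    (\<Sum>j\<le>m - i. 2 ^ (i + j) * real ((2 * (m - i - j)) choose (m - i - j)) *
      real ((m + (i + j)) choose (i + j)) * real ((i + j) choose i))"
proof -
  let ?c = "\<lambda>k. 2 ^ k * real ((2 * m - 2 * k) choose (m - k)) * real ((m + k) choose k)"
  have coeff: "coeff ([:1, 1:] ^ k) i = real (k choose i)" for k
  proof (cases "i \<le> k")
    case False
    have "degree ([:1, 1 :: real:] ^ k) \<le> k"
      using degree_power_le[of "[:1, 1 :: real:]" k] by simp
    with False show ?thesis by (simp add: coeff_eq_0)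
  qed (simp add: coeff_linear_poly_power)
  have "boros_moll_coeff i m = 1 / 2 ^ (2 * m) * (\<Sum>k=0..m. ?c k * real (k choose i))"
    by (simp add: boros_moll_coeff_def boros_moll_poly_def coeff_sum coeff)
  also have "(\<Sum>k=0..m. ?c k * real (k choose i)) = (\<Sum>k=i..m. ?c k * real (k choose i))"
    by (rule sum.mono_neutral_right) auto
  also have "\<dots> = (\<Sum>j\<le>m - i. ?c (i + j) * real ((i + j) choose i))"
    using assms by (intro sum.reindex_bij_witness[of _ "\<lambda>j. i + j" "\<lambda>k. k - i"]) auto
  finally show ?thesis by (simp add: diff_mult_distrib2 diff_diff_left)
qed

text \<open>
  This is the duplication formula for the factorial. In terms of generating functions, both sides,
  divided by \<open>fact n\<close>, are the coefficient of \<open>t ^ n\<close> in \<open>(1 - t) powr (- 1 / 2)\<close>.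
\<close>

lemma pochhammer_half_eq_central_binomial:
  "pochhammer (1 / 2 :: real) n = real ((2 * n) choose n) * fact n / 2 ^ (2 * n)"
proof -
  have "real ((2 * n) choose n) = fact (2 * n) / (fact n * fact n)"
    using binomial_fact[of n "2 * n"] by simp
  then show ?thesis by (simp add: fact_double)
qed

theorem theorem2p1:
  fixes m i :: nat
  assumes "m \<ge> 1" and "i \<le> m"
  shows "normalized_coeff i m = (\<Sum>x\<in>colored_perms_black i m. weight x)"
proof -
  let ?N = "real ((2 * m) choose (m - i))"
  have summand: "fact m * fact i * fact (m - i) * 2 ^ i * (1 / 2 ^ (2 * m)) *
      (2 ^ (i + j) * real ((2 * (m - i - j)) choose (m - i - j)) *
        real ((m + (i + j)) choose (i + j)) * real ((i + j) choose i))
    = real ((m - i) choose j) *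
      ((1 / 2) ^ j * fact (m + i + j) * pochhammer (1 / 2) (m - i - j))"
    if "j \<le> m - i" for j
  proof -
    define n where "n = m - i - j"
    with that assms have m: "m = i + j + n" by simp
    let ?b = "real ((2 * n) choose n)"
    let ?c = "real ((m + (i + j)) choose (i + j)) * real ((i + j) choose i)"
    have black: "fact m * fact i * ?c = fact (m + i + j) / fact j"
      using binomial_fact[of "i + j" "m + (i + j)", where ?'a = real]
        binomial_fact[of i "i + j", where ?'a = real] by (simp add: add_ac)
    have white: "real ((m - i) choose j) = fact (m - i) / (fact j * fact n)"
      using binomial_fact[of j "m - i", where ?'a = real] that by (simp add: n_def)
    have two: "2 ^ i * (1 / 2 ^ (2 * m)) * 2 ^ (i + j) = (1 / 2) ^ j / (2 :: real) ^ (2 * n)"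
      by (simp add: m power_add power_mult_distrib field_simps mult_2 mult_2_right)
    have "fact m * fact i * fact (m - i) * 2 ^ i * (1 / 2 ^ (2 * m)) *
        (2 ^ (i + j) * ?b * real ((m + (i + j)) choose (i + j)) * real ((i + j) choose i))
      = fact (m - i) * ?b * (2 ^ i * (1 / 2 ^ (2 * m)) * 2 ^ (i + j)) * (fact m * fact i * ?c)"
      by (simp only: mult_ac)
    also have "\<dots> = fact (m - i) * ?b * ((1 / 2) ^ j / 2 ^ (2 * n)) * (fact (m + i + j) / fact j)"
      by (simp only: two black)
    also have "\<dots> = real ((m - i) choose j) *
        ((1 / 2) ^ j * fact (m + i + j) * pochhammer (1 / 2) n)"
      unfolding white pochhammer_half_eq_central_binomial by (simp add: mult_ac)
    finally show ?thesis unfolding n_def .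
  qed
  have "normalized_coeff i m = ?N * (\<Sum>j\<le>m - i.
      fact m * fact i * fact (m - i) * 2 ^ i * (1 / 2 ^ (2 * m)) *
      (2 ^ (i + j) * real ((2 * (m - i - j)) choose (m - i - j)) *
        real ((m + (i + j)) choose (i + j)) * real ((i + j) choose i)))"
    unfolding normalized_coeff_def boros_moll_coeff_eq_sum[OF assms(2)] sum_distrib_left
    by (intro sum.cong refl) (simp add: mult_ac)
  also have "\<dots> = (\<Sum>x\<in>colored_perms_black i m. weight x)"
    unfolding sum_weight_colored_perms_black[OF assms(2)]
    using summand by (intro arg_cong[of _ _ "\<lambda>s. ?N * s"] sum.cong) auto
  finally show ?thesis .
qed

end
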